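(* Let $N\ge 2$ and $n\ge 1$ be integers, let $h>0$ and let $\vec J=(J_1,\dots,J_n)$ with $J_i>0$ for all $i$. Consider the Hamiltonian $\mathcal H$ on $\Omega=\{-1,+1\}^{\Lambda_N^n}$ described in the context. Suppose that $\vec J$ is monotone, i.e. either $J_1\ge J_2\ge\dots\ge J_n$ or $J_1\le J_2\le\dots\le J_n$, and that $$\Big(1-\frac1N\Big)\sum_{i=1}^n J_iN^i>h .$$ Then $\Omega_{\mathrm{meta}}=\{\boxminus\}$.
   Context: The hierarchical lattice $\Lambda_N^n=\{1,2,\dots,N^n\}$; the integer $a$ is identified with a vertex $v_a$. For $0\le k\le n$, the sets $\{jN^k+1,\dots,(j+1)N^k\}$, $0\le j<N^{n-k}$, are the $k$-blocks. The hierarchical distance $d(a,b)$ is the smallest $k\ge 0$ such that $a$ and $b$ lie in a common $k$-block. A configuration $\sigma\in\Omega=\{-1,+1\}^{\Lambda_N^n}$ is identified with the set $\{v:\sigma(v)=+1\}$; $\boxminus\equiv -1$, $\boxplus\equiv+1$. The Hamiltonian is $$\mathcal H(\sigma)=-\frac12\sum_{\{v,w\}:\,v\neq w}J_{d(v,w)}\sigma(v)\sigma(w)-\frac h2\sum_{v}\sigma(v),$$ the first sum over unordered pairs of distinct vertices (so that flipping one spin changes the interaction energy by $J_{d(v,w)}$ per pair whose agreement status changes; equivalently $\mathcal H(\sigma)-\mathcal H(\boxminus)=\sum_{v\in\sigma,\,w\notin\sigma}J_{d(v,w)}-h|\sigma|$). Two configurations are neighbours ($\sigma\sim\eta$) if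 they differ at exactly one vertex; a path is a sequence of configurations in which consecutive ones are neighbours. The communication height is $\Phi(\sigma,\eta)=\min_{\text{paths }\sigma\to\eta}\max_{\xi\in\text{path}}\mathcal H(\xi)$. The stability level of $\sigma$ is $V_\sigma=\min_{\eta:\mathcal H(\eta)<\mathcal H(\sigma)}\Phi(\sigma,\eta)-\mathcal H(\sigma)$. $\Omega_{\mathrm{stab}}$ is the set of global minimisers of $\mathcal H$, and $\Omega_{\mathrm{meta}}=\{\sigma\in\Omega\setminus\Omega_{\mathrm{stab}}: V_\sigma=\max_{\eta\in\Omega\setminus\Omega_{\mathrm{stab}}}V_\eta\}$. *)

theory Defs
  imports Complex_Main
begin

text \<open>Hierarchical lattice with vertices 1..N^n; configurations are identified with
  the set of vertices carrying spin +1.\<close>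

definition vertices :: "nat \<Rightarrow> nat \<Rightarrow> nat set" where
  "vertices N n = {1..N^n}"

definition configs :: "nat \<Rightarrow> nat \<Rightarrow> nat set set" where
  "configs N n = Pow (vertices N n)"

text \<open>Hierarchical distance: least k such that a and b lie in a common k-block
  {jN^k+1, ..., (j+1)N^k}.\<close>
definition hdist :: "nat \<Rightarrow> nat \<Rightarrow> nat \<Rightarrow> nat" where
  "hdist N a b = (LEAST k. (a - 1) div N^k = (b - 1) div N^k)"

definition spin :: "nat set \<Rightarrow> nat \<Rightarrow> real" where
  "spin \<sigma> v = (if v \<in> \<sigma> then 1 else -1)"

text \<open>Hamiltonian; the sum over unordered pairs of distinct vertices is written as
  half the sum over ordered pairs.\<close>
definition Ham :: "nat \<Rightarrow> nat \<Rightarrow> (nat \<Rightarrow> real) \<Rightarrow> real \<Rightarrow> nat set \<Rightarrow> real" where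
  "Ham N n J h \<sigma> =
     - (1/2) * ((1/2) * (\<Sum>v\<in>vertices N n. \<Sum>w\<in>vertices N n - {v}.
                    J (hdist N v w) * spin \<sigma> v * spin \<sigma> w))
     - (h/2) * (\<Sum>v\<in>vertices N n. spin \<sigma> v)"

definition neighbours :: "nat \<Rightarrow> nat \<Rightarrow> nat set \<Rightarrow> nat set \<Rightarrow> bool" where
  "neighbours N n \<sigma> \<eta> \<longleftrightarrow> \<sigma> \<in> configs N n \<and> \<eta> \<in> configs N n \<and>
     (\<exists>v\<in>vertices N n. \<eta> = \<sigma> \<union> {v} - (\<sigma> \<inter> {v}))"

definition is_path :: "nat \<Rightarrow> nat \<Rightarrow> nat set list \<Rightarrow> nat set \<Rightarrow> nat set \<Rightarrow> bool" where
  "is_path N n p \<sigma> \<eta> \<longleftrightarrow> p \<noteq> [] \<and> hd p = \<sigma> \<and> last p = \<eta> \<and>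
     set p \<subseteq> configs N n \<and>
     (\<forall>i. Suc i < length p \<longrightarrow> neighbours N n (p ! i) (p ! Suc i))"

definition comm_height :: "nat \<Rightarrow> nat \<Rightarrow> (nat \<Rightarrow> real) \<Rightarrow> real \<Rightarrow> nat set \<Rightarrow> nat set \<Rightarrow> real" where
  "comm_height N n J h \<sigma> \<eta> =
     Inf {Max (Ham N n J h ` set p) | p. is_path N n p \<sigma> \<eta>}"

definition stab_level :: "nat \<Rightarrow> nat \<Rightarrow> (nat \<Rightarrow> real) \<Rightarrow> real \<Rightarrow> nat set \<Rightarrow> real" where
  "stab_level N n J h \<sigma> =
     Inf {comm_height N n J h \<sigma> \<eta> | \<eta>. \<eta> \<in> configs N n \<and> Ham N n J h \<eta> < Ham N n J h \<sigma>}
     - Ham N n J h \<sigma>"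

definition Omega_stab :: "nat \<Rightarrow> nat \<Rightarrow> (nat \<Rightarrow> real) \<Rightarrow> real \<Rightarrow> nat set set" where
  "Omega_stab N n J h =
     {\<sigma> \<in> configs N n. \<forall>\<eta>\<in>configs N n. Ham N n J h \<sigma> \<le> Ham N n J h \<eta>}"

definition Omega_meta :: "nat \<Rightarrow> nat \<Rightarrow> (nat \<Rightarrow> real) \<Rightarrow> real \<Rightarrow> nat set set" where
  "Omega_meta N n J h =
     {\<sigma> \<in> configs N n - Omega_stab N n J h.
        stab_level N n J h \<sigma> =
          Max (stab_level N n J h ` (configs N n - Omega_stab N n J h))}"

end

theory Submission
  imports Defs
begin

text \<open>The energy \<open>H\<close> is submodular, strictly so on incomparable sets, because every
  coupling is positive. Let \<open>c\<close> be the height of an optimal path from the empty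
  configuration to one of lower energy. Uncrossing turns this path into an increasing chain
  of height at most \<open>c\<close>; among all such chains take one whose end
  \<open>insert u A\<close> is smallest, so that no subset of \<open>A\<close> lies below the empty configuration
  and every proper subset of \<open>insert u A\<close> has larger energy than \<open>insert u A\<close>. For any
  other \<open>\<sigma>\<close> that is not full, submodularity applied to \<open>\<sigma>\<close> and the sets \<open>C\<close> of the chain
  shows that along \<open>\<sigma> \<union> C\<close> the energy rises by at most \<open>c - H {}\<close> and ends below \<open>H \<sigma>\<close>.
  Moving the chain by an automorphism of the lattice ensures that \<open>A\<close> does not contain \<open>\<sigma>\<close>,
  which makes the rise strictly smaller, and that \<open>\<sigma>\<close> does not contain \<open>insert u A\<close>.\<close>

section \<open>Growing chains of a submodular energy\<close>

locale strictly_submodular =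
  fixes V :: "'a set" and f :: "'a set \<Rightarrow> real"
  assumes finite_V: "finite V"
    and strict_submodular: "\<lbrakk>A \<subseteq> V; B \<subseteq> V; \<not> A \<subseteq> B; \<not> B \<subseteq> A\<rbrakk>
      \<Longrightarrow> f (A \<union> B) + f (A \<inter> B) < f A + f B"
begin

lemma submodular:
  assumes "A \<subseteq> V" "B \<subseteq> V"
  shows "f (A \<union> B) + f (A \<inter> B) \<le> f A + f B"
proof (cases "A \<subseteq> B \<or> B \<subseteq> A")
  case True
  then show ?thesis by (auto simp: Un_absorb1 Un_absorb2 Int_absorb1 Int_absorb2)
next
  case False
  then show ?thesis using strict_submodular[OF assms] by simp
qed

text \<open>An increasing path is recorded only through its end; the order of insertions lives in
  the derivation, so rule induction walks along the chain. The bound \<open>c\<close> is imposed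
  after each insertion, not on the starting set.\<close>

inductive grows :: "real \<Rightarrow> 'a set \<Rightarrow> bool" for c where
  empty: "grows c {}"
| insert: "\<lbrakk>grows c A; v \<in> V; v \<notin> A; f (insert v A) \<le> c\<rbrakk> \<Longrightarrow> grows c (insert v A)"

lemma grows_subset: "grows c A \<Longrightarrow> A \<subseteq> V"
  by (induction rule: grows.induct) auto

text \<open>Uncrossing: when a vertex of \<open>B\<close> joins \<open>A\<close>, submodularity for
  \<open>insert v A\<close> and \<open>B\<close>, together with
  \<open>f B \<le> f (insert v A \<union> B)\<close>, bounds the energy of the new intersection by
  \<open>f (insert v A) \<le> c\<close>. Vertices outside \<open>B\<close> leave the intersection
  unchanged.\<close>

lemma grows_Int:
  assumes "grows c A" "B \<subseteq> V" "\<And>D. \<lbrakk>B \<subseteq> D; D \<subseteq> A \<union> B\<rbrakk> \<Longrightarrow> f B \<le> f D"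
  shows "grows c (A \<inter> B)"
  using assms
proof (induction rule: grows.induct)
  case empty
  then show ?case by (simp add: grows.empty)
next
  case (insert A v)
  have IH: "grows c (A \<inter> B)"
    using insert.prems by (intro insert.IH) auto
  show ?case
  proof (cases "v \<in> B")
    case True
    have "f (insert v A \<union> B) + f (insert v A \<inter> B) \<le> f (insert v A) + f B"
      using insert.hyps insert.prems grows_subset by (intro submodular) auto
    moreover have "f B \<le> f (insert v A \<union> B)"
      by (rule insert.prems) auto
    ultimately have "f (insert v (A \<inter> B)) \<le> c"
      using True insert.hyps by simp
    then show ?thesis
      using True IH insert.hyps by (auto intro: grows.insert)
  next
    case False
    then show ?thesis using IH by simp
  qed
qed

lemma grows_image:
  assumes "grows c A" "bij_betw g V V" "\<And>A. A \<subseteq> V \<Longrightarrow> f (g ` A) = f A"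
  shows "grows c (g ` A)"
  using assms(1)
proof (induction rule: grows.induct)
  case (insert A v)
  have "g v \<in> V" "g v \<notin> g ` A"
    using insert.hyps grows_subset[OF insert.hyps(1)] assms(2)
    by (auto simp: bij_betw_def inj_on_def)
  moreover have "f (insert (g v) (g ` A)) \<le> c"
    using insert.hyps assms(3)[of "insert v A"] grows_subset[OF insert.hyps(1)] by simp
  ultimately show ?case
    using insert.IH by (simp add: grows.insert)
qed (simp add: grows.empty)

lemma finite_minimiser:
  assumes "finite S" "S \<noteq> {}"
  shows "\<exists>B\<in>S. \<forall>D\<in>S. f B \<le> f D"
  using ex_min_if_finite[of "f ` S"] assms by (force simp: not_less)

text \<open>Every set between a minimiser \<open>B\<close> and \<open>A\<close> lies in the interval
  on which \<open>B\<close> is minimal, so \<open>grows_Int\<close> applies and returns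
  \<open>A \<inter> B = B\<close>.\<close>

lemma grows_minimiser:
  assumes "grows c A" "X \<subseteq> A"
  shows "\<exists>B. grows c B \<and> X \<subseteq> B \<and> B \<subseteq> A \<and> (\<forall>D. X \<subseteq> D \<and> D \<subseteq> A \<longrightarrow> f B \<le> f D)"
proof -
  have "finite {D. X \<subseteq> D \<and> D \<subseteq> A}"
    by (rule finite_subset[of _ "Pow V"]) (use finite_V grows_subset[OF assms(1)] in auto)
  moreover have "{D. X \<subseteq> D \<and> D \<subseteq> A} \<noteq> {}" using assms(2) by blast
  ultimately obtain B where B: "X \<subseteq> B" "B \<subseteq> A"
      "\<And>D. \<lbrakk>X \<subseteq> D; D \<subseteq> A\<rbrakk> \<Longrightarrow> f B \<le> f D"
    using finite_minimiser by (metis (mono_tags, lifting) mem_Collect_eq)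
  have "grows c (A \<inter> B)"
  proof (rule grows_Int[OF assms(1)])
    show "B \<subseteq> V" using B(2) grows_subset[OF assms(1)] by blast
    show "f B \<le> f D" if "B \<subseteq> D" "D \<subseteq> A \<union> B" for D
      using that B(1,2) by (intro B(3)) auto
  qed
  moreover have "A \<inter> B = B" using B(2) by blast
  ultimately show ?thesis
    using B by auto
qed

text \<open>The grown set is kept minimal on the interval between the current
  configuration and itself, so a spin flip of the configuration can be copied onto it.\<close>

lemma path_dominated_by_grows:
  assumes start: "p 0 = {}"
    and step: "\<And>i. i < m \<Longrightarrow> \<exists>v\<in>V. p (Suc i) = insert v (p i) \<or> p (Suc i) = p i - {v}"
    and height: "\<And>i. i \<le> m \<Longrightarrow> f (p i) \<le> c"
  shows "\<exists>A. grows c A \<and> f A \<le> f (p m)"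
proof -
  have "\<exists>A. grows c A \<and> p i \<subseteq> A \<and> (\<forall>B. p i \<subseteq> B \<and> B \<subseteq> A \<longrightarrow> f A \<le> f B)" if "i \<le> m" for i
    using that
  proof (induction i)
    case 0
    show ?case using start by (auto intro!: exI[of _ "{}"] grows.empty)
  next
    case (Suc i)
    then obtain A where A: "grows c A" "p i \<subseteq> A"
        "\<And>B. \<lbrakk>p i \<subseteq> B; B \<subseteq> A\<rbrakk> \<Longrightarrow> f A \<le> f B"
      by auto
    obtain v where v: "v \<in> V" "p (Suc i) = insert v (p i) \<or> p (Suc i) = p i - {v}"
      using step[of i] Suc.prems by auto
    obtain A' where A': "grows c A'" "p (Suc i) \<subseteq> A'"
    proof (cases "p (Suc i) \<subseteq> A")
      case True
      then show thesis using that A by blast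
    next
      case False
      then have p: "p (Suc i) = insert v (p i)" and "v \<notin> A"
        using v A(2) by auto
      \<comment> \<open>Submodularity and the minimality of \<open>A\<close> against
        \<open>p i\<close> give \<open>f (insert v A) \<le> f (p (Suc i)) \<le> c\<close>.\<close>
      have "f (A \<union> insert v (p i)) + f (A \<inter> insert v (p i)) \<le> f A + f (insert v (p i))"
        using v grows_subset[OF A(1)] A(2) by (intro submodular) auto
      moreover have "A \<union> insert v (p i) = insert v A" "A \<inter> insert v (p i) = p i"
        using A(2) \<open>v \<notin> A\<close> by auto
      moreover have "f A \<le> f (p i)"
        using A(2,3) by simp
      ultimately have "f (insert v A) \<le> c"
        using height[of "Suc i"] Suc.prems p by simp
      then have "grows c (insert v A)"
        using A(1) v(1) \<open>v \<notin> A\<close> by (rule grows.insert[rotated 3])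
      then show thesis using that p A(2) by blast
    qed
    \<comment> \<open>Shrinking to a minimiser restores the invariant on the interval that starts at
      \<open>p (Suc i)\<close>.\<close>
    from grows_minimiser[OF this] obtain B where "grows c B" "p (Suc i) \<subseteq> B" "B \<subseteq> A'"
        "\<forall>D. p (Suc i) \<subseteq> D \<and> D \<subseteq> A' \<longrightarrow> f B \<le> f D"
      by auto
    then show ?case by (meson order_trans)
  qed
  then show ?thesis by blast
qed

text \<open>Least cardinality among all grown sets below \<open>f {}\<close> yields both energy
  properties: a violating subset could be replaced by a grown minimiser that is smaller and still
  below the empty set. Automorphisms preserve growth, energy and cardinality, which leaves freedom
  to place the droplet relative to \<sigma>.\<close>

lemma critical_droplet:
  assumes "grows c A0" "f A0 < f {}"
    and trans: "\<And>u w. \<lbrakk>u \<in> V; w \<in> V\<rbrakk>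
      \<Longrightarrow> \<exists>g. bij_betw g V V \<and> g u = w \<and> (\<forall>A\<subseteq>V. f (g ` A) = f A)"
    and \<sigma>: "\<sigma> \<subseteq> V" "\<sigma> \<noteq> {}" "\<sigma> \<noteq> V"
  obtains A u where "grows c A" "u \<in> V" "u \<notin> A" "\<not> \<sigma> \<subseteq> A" "\<not> insert u A \<subseteq> \<sigma>"
    "\<And>B. B \<subseteq> A \<Longrightarrow> f {} \<le> f B" "\<And>B. B \<subset> insert u A \<Longrightarrow> f (insert u A) < f B"
proof -
  obtain A1 where A1: "grows c A1" "f A1 < f {}"
    and min: "\<And>B. \<lbrakk>grows c B; f B < f {}\<rbrakk> \<Longrightarrow> card A1 \<le> card B"
    using ex_has_least_nat[of "\<lambda>A. grows c A \<and> f A < f {}" A0 card] assms(1,2) by blast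
  from A1 obtain A2 v where A2: "A1 = insert v A2" "grows c A2" "v \<in> V" "v \<notin> A2"
      "f (insert v A2) \<le> c"
    by (cases rule: grows.cases) auto
  \<comment> \<open>The automorphism sends the last vertex of the chain into \<open>\<sigma>\<close> if \<open>\<sigma>\<close> is small
    and out of \<open>\<sigma>\<close> otherwise; cardinality settles the other non-inclusion.\<close>
  obtain w where w: "w \<in> V" "if card \<sigma> < card A1 then w \<in> \<sigma> else w \<notin> \<sigma>"
    using \<sigma> by (cases "card \<sigma> < card A1") auto
  obtain g where g: "bij_betw g V V" "g v = w" "\<And>A. A \<subseteq> V \<Longrightarrow> f (g ` A) = f A"
    using trans[OF A2(3) w(1)] by blast
  define A where "A = g ` A2"
  have A: "grows c A" and A': "grows c (insert w A)"
    using grows_image[OF A2(2) g(1,3)] grows_image[OF A1(1) g(1,3)] A2(1) g(2)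
    unfolding A_def by simp_all
  have inj: "inj_on g V" using g(1) by (simp add: bij_betw_def)
  have wA: "w \<notin> A"
    using inj A2 grows_subset[OF A2(2)] g(2) unfolding A_def inj_on_def by blast
  have fA: "f (insert w A) < f {}"
    using g(3)[of A1] g(2) A1(2) grows_subset[OF A1(1)] A2(1) unfolding A_def by simp
  have fin: "finite A" and "finite \<sigma>"
    using grows_subset[OF A] \<sigma>(1) finite_V by (auto intro: finite_subset)
  \<comment> \<open>The minimality \<open>min\<close> ranges over all grown sets, not only over
    subsets of \<open>A1\<close>, so it applies to the moved chain once the cardinality is
    known.\<close>
  have "card A = card A2"
    unfolding A_def using inj grows_subset[OF A2(2)] by (metis card_image inj_on_subset)
  moreover have "finite A2"
    using grows_subset[OF A2(2)] finite_V by (rule finite_subset)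
  ultimately have card: "card A1 = Suc (card A)"
    using A2 by simp
  show thesis
  proof (rule that[OF A w(1) wA])
    show "\<not> \<sigma> \<subseteq> A"
    proof
      assume "\<sigma> \<subseteq> A"
      then show False
        using w(2) wA card card_mono[OF fin, of \<sigma>] by auto
    qed
    show "\<not> insert w A \<subseteq> \<sigma>"
    proof
      assume sub: "insert w A \<subseteq> \<sigma>"
      then have "card A1 \<le> card \<sigma>"
        using card_mono[OF \<open>finite \<sigma>\<close> sub] wA fin card by simp
      then show False
        using w(2) sub by simp
    qed
  next
    fix B assume "B \<subseteq> A"
    obtain D where D: "grows c D" "D \<subseteq> A" "\<And>E. E \<subseteq> A \<Longrightarrow> f D \<le> f E"
      using grows_minimiser[OF A empty_subsetI] by auto
    have "card D < card A1"
      using card card_mono[OF fin D(2)] by simp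
    then show "f {} \<le> f B"
      using min[OF D(1)] D(3)[OF \<open>B \<subseteq> A\<close>] by linarith
  next
    fix B assume B: "B \<subset> insert w A"
    show "f (insert w A) < f B"
    proof (rule ccontr)
      assume not_less: "\<not> f (insert w A) < f B"
      \<comment> \<open>If \<open>B\<close> is no worse than the whole droplet, the best proper
        subset \<open>D\<close> is minimal among all subsets, which makes it grown.\<close>
      have "finite {D. D \<subset> insert w A}"
        by (rule finite_subset[of _ "Pow (insert w A)"]) (use fin in auto)
      from finite_minimiser[OF this] obtain D
        where D: "D \<subset> insert w A" "\<And>E. E \<subset> insert w A \<Longrightarrow> f D \<le> f E"
        using B by auto
      have "grows c (insert w A \<inter> D)"
      proof (rule grows_Int[OF A'])
        show "D \<subseteq> V" using D(1) grows_subset[OF A'] by auto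
        show "f D \<le> f E" if "D \<subseteq> E" "E \<subseteq> insert w A \<union> D" for E
        proof (cases "E = insert w A")
          case True
          then show ?thesis using not_less D(2)[OF B] by simp
        next
          case False
          then have "E \<subset> insert w A" using that D(1) by blast
          then show ?thesis by (rule D(2))
        qed
      qed
      moreover have "insert w A \<inter> D = D" using D(1) by blast
      ultimately have "grows c D" by simp
      moreover have "f D < f {}" using D(2)[OF B] not_less fA by simp
      moreover have "card D < card A1"
        using card wA fin psubset_card_mono[OF _ D(1)] by simp
      ultimately show False using min[of D] by simp
    qed
  qed
qed

text \<open>Submodularity bounds the rise by \<open>c - f (A \<inter> \<sigma>)\<close>. Strictness
  has two sources: incomparability of the sets or, if \<open>A \<subseteq> \<sigma>\<close>, the
  inequality \<open>f {} < c\<close>, since the union is then \<sigma>.\<close>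

lemma union_height:
  assumes "A \<subseteq> V" "\<sigma> \<subseteq> V" "f A \<le> c" "f {} < c" "\<not> \<sigma> \<subseteq> A" "f {} \<le> f (A \<inter> \<sigma>)"
  shows "f (\<sigma> \<union> A) < f \<sigma> + (c - f {})"
proof (cases "A \<subseteq> \<sigma>")
  case True
  then show ?thesis using assms by (simp add: Un_absorb2)
next
  case False
  then show ?thesis
    using strict_submodular[of \<sigma> A] assms by (simp add: Int_commute)
qed

end

section \<open>Paths and stability levels\<close>

text \<open>The case \<open>v \<in> \<eta>\<close> is allowed so that a chain can be replayed on top
  of \<sigma>: vertices already occupied add no step.\<close>

lemma is_path_insert:
  assumes "is_path N n p \<sigma> \<eta>" "v \<in> vertices N n"
  shows "\<exists>q. is_path N n q \<sigma> (insert v \<eta>) \<and> set q \<subseteq> insert (insert v \<eta>) (set p)"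
proof (cases "v \<in> \<eta>")
  case True
  then show ?thesis using assms(1) by (intro exI[of _ p]) (auto simp: insert_absorb)
next
  case False
  have p: "p \<noteq> []" "hd p = \<sigma>" "last p = \<eta>" "set p \<subseteq> configs N n"
      "\<And>i. Suc i < length p \<Longrightarrow> neighbours N n (p ! i) (p ! Suc i)"
    using assms(1) by (auto simp: is_path_def)
  have \<eta>: "\<eta> \<in> configs N n"
    using p(1,3,4) by auto
  have ins: "insert v \<eta> \<in> configs N n"
    using \<eta> assms(2) by (simp add: configs_def)
  have "neighbours N n \<eta> (insert v \<eta>)"
    using False assms(2) \<eta> ins by (auto simp: neighbours_def intro!: bexI[of _ v])
  moreover have "p ! i = \<eta>" if "Suc i = length p" for i
    using p(1,3) by (simp add: last_conv_nth flip: that)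
  ultimately have "neighbours N n ((p @ [insert v \<eta>]) ! i) ((p @ [insert v \<eta>]) ! Suc i)"
    if "Suc i < length (p @ [insert v \<eta>])" for i
    using that p(5)[of i] by (cases "Suc i = length p") (auto simp: nth_append)
  then have "is_path N n (p @ [insert v \<eta>]) \<sigma> (insert v \<eta>)"
    using p ins by (simp add: is_path_def)
  then show ?thesis
    by (intro exI[of _ "p @ [insert v \<eta>]"]) auto
qed

lemma is_path_refl: "\<sigma> \<in> configs N n \<Longrightarrow> is_path N n [\<sigma>] \<sigma> \<sigma>"
  by (simp add: is_path_def)

lemma finite_configs: "finite (configs N n)"
  by (simp add: configs_def vertices_def)

text \<open>Without a path, the infimum defining \<open>comm_height\<close> would run over the empty
  set.\<close>

lemma ex_path_from_empty:
  assumes "\<eta> \<in> configs N n"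
  shows "\<exists>p. is_path N n p {} \<eta>"
proof -
  have "finite \<eta>" "\<eta> \<subseteq> vertices N n"
    using assms by (auto simp: configs_def vertices_def intro: finite_subset)
  then show ?thesis
  proof (induction \<eta> rule: finite_induct)
    case empty
    have "{} \<in> configs N n" by (simp add: configs_def)
    then show ?case using is_path_refl by blast
  next
    case (insert v \<eta>)
    then show ?case using is_path_insert by (metis insert_subset)
  qed
qed

text \<open>Paths may be arbitrarily long, but each height is the energy of one of finitely many
  configurations. This turns the infimum into a minimum.\<close>

lemma finite_path_heights: "finite {Max (Ham N n J h ` set p) | p. is_path N n p \<sigma> \<eta>}"
proof (rule finite_subset)
  show "{Max (Ham N n J h ` set p) | p. is_path N n p \<sigma> \<eta>} \<subseteq> Ham N n J h ` configs N n"
  proof clarify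
    fix p assume "is_path N n p \<sigma> \<eta>"
    then have "set p \<subseteq> configs N n" "p \<noteq> []" by (auto simp: is_path_def)
    then have "Max (Ham N n J h ` set p) \<in> Ham N n J h ` set p" by (intro Max_in) auto
    then show "Max (Ham N n J h ` set p) \<in> Ham N n J h ` configs N n"
      using \<open>set p \<subseteq> configs N n\<close> by blast
  qed
  show "finite (Ham N n J h ` configs N n)" using finite_configs by blast
qed

lemma stab_level_less:
  assumes "is_path N n p \<sigma> \<eta>" "Ham N n J h \<eta> < Ham N n J h \<sigma>"
    and "\<And>\<xi>. \<xi> \<in> set p \<Longrightarrow> Ham N n J h \<xi> < Ham N n J h \<sigma> + c"
  shows "stab_level N n J h \<sigma> < c"
proof -
  have p: "p \<noteq> []" "\<eta> \<in> configs N n"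
    using assms(1) by (auto simp: is_path_def)
  let ?S = "{comm_height N n J h \<sigma> \<eta> | \<eta>. \<eta> \<in> configs N n \<and> Ham N n J h \<eta> < Ham N n J h \<sigma>}"
  have "finite ?S" using finite_configs by simp
  then have "Inf ?S \<le> comm_height N n J h \<sigma> \<eta>"
    using p(2) assms(2) by (intro cInf_lower bdd_below_finite) auto
  also have "\<dots> \<le> Max (Ham N n J h ` set p)"
    unfolding comm_height_def
    using assms(1) by (intro cInf_lower bdd_below_finite finite_path_heights) auto
  also have "\<dots> < Ham N n J h \<sigma> + c"
    using p(1) assms(3) by simp
  finally show ?thesis by (simp add: stab_level_def)
qed

text \<open>Both nested infima run over finite nonempty sets: \<open>\<eta>0\<close> makes the outer
  one nonempty, \<open>ex_path_from_empty\<close> the inner one.\<close>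

lemma stab_level_empty_attained:
  assumes "\<eta>0 \<in> configs N n" "Ham N n J h \<eta>0 < Ham N n J h {}"
  shows "\<exists>p \<eta>. is_path N n p {} \<eta> \<and> Ham N n J h \<eta> < Ham N n J h {} \<and>
    Max (Ham N n J h ` set p) = Ham N n J h {} + stab_level N n J h {}"
proof -
  let ?S = "{comm_height N n J h {} \<eta> | \<eta>. \<eta> \<in> configs N n \<and> Ham N n J h \<eta> < Ham N n J h {}}"
  have "finite ?S" "?S \<noteq> {}" using finite_configs assms by auto
  then have "Inf ?S \<in> ?S" by (metis (no_types, lifting) Min_in cInf_eq_Min)
  then obtain \<eta> where \<eta>: "Inf ?S = comm_height N n J h {} \<eta>" "\<eta> \<in> configs N n"
      "Ham N n J h \<eta> < Ham N n J h {}"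
    by blast
  let ?T = "{Max (Ham N n J h ` set p) | p. is_path N n p {} \<eta>}"
  have "?T \<noteq> {}" using ex_path_from_empty[OF \<eta>(2)] by blast
  with finite_path_heights[of N n J h "{}" \<eta>] have "Inf ?T \<in> ?T"
    by (metis (no_types, lifting) Min_in cInf_eq_Min)
  then obtain p where "is_path N n p {} \<eta>" "comm_height N n J h {} \<eta> = Max (Ham N n J h ` set p)"
    unfolding comm_height_def by blast
  then show ?thesis using \<eta> by (auto simp: stab_level_def)
qed

section \<open>The hierarchical lattice\<close>

lemma block_transitive:
  fixes N u w n :: nat
  assumes "N \<ge> 1" "u < N ^ n" "w < N ^ n"
  shows "\<exists>g. bij_betw g {..<N ^ n} {..<N ^ n} \<and> g u = w \<and>
    (\<forall>x y k. g x div N ^ k = g y div N ^ k \<longleftrightarrow> x div N ^ k = y div N ^ k)"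
  using assms(2,3)
proof (induction n arbitrary: u w)
  case 0
  then have "u = 0" "w = 0" by auto
  then show ?case by (intro exI[of _ id]) (auto simp: bij_betw_def)
next
  case (Suc n)
  have "u div N < N ^ n" "w div N < N ^ n"
    using Suc.prems by (auto simp: less_mult_imp_div_less mult.commute)
  then obtain g where g: "bij_betw g {..<N ^ n} {..<N ^ n}" "g (u div N) = w div N"
      "\<And>x y k. g x div N ^ k = g y div N ^ k \<longleftrightarrow> x div N ^ k = y div N ^ k"
    using Suc.IH by blast
  \<comment> \<open>Base \<open>N\<close> digits: transpose two values of the last digit, apply \<open>g\<close> to the others.\<close>
  define t where "t d = (if d = u mod N then w mod N else if d = w mod N then u mod N else d)" for d
  define G where "G x = N * g (x div N) + t (x mod N)" for x
  have t_less: "t (x mod N) < N" for x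
    using assms(1) by (simp add: t_def)
  have t_inj: "t d = t e \<longleftrightarrow> d = e" for d e
    by (auto simp: t_def)
  have G_div: "G x div N = g (x div N)" and G_mod: "G x mod N = t (x mod N)" for x
    using t_less[of x] assms(1) by (simp_all add: G_def)
  have block: "G x div N ^ k = G y div N ^ k \<longleftrightarrow> x div N ^ k = y div N ^ k" for x y k
  proof (cases k)
    case 0
    have "G x = G y \<longleftrightarrow> G x div N = G y div N \<and> G x mod N = G y mod N"
      by (metis mult_div_mod_eq)
    also have "\<dots> \<longleftrightarrow> x div N = y div N \<and> x mod N = y mod N"
      using g(3)[of "x div N" 0 "y div N"] by (simp add: G_div G_mod t_inj)
    also have "\<dots> \<longleftrightarrow> x = y" by (metis mult_div_mod_eq)
    finally show ?thesis using 0 by simp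
  next
    case (Suc j)
    then show ?thesis
      using g(3)[of "x div N" j "y div N"] by (simp add: div_mult2_eq G_div)
  qed
  have "G u = w"
    by (metis G_def g(2) t_def mult_div_mod_eq)
  moreover have "bij_betw G {..<N ^ Suc n} {..<N ^ Suc n}"
  proof -
    have inj: "inj_on G {..<N ^ Suc n}"
      using block[of _ 0] by (auto simp: inj_on_def)
    have "G ` {..<N ^ Suc n} \<subseteq> {..<N ^ Suc n}"
    proof clarsimp
      fix x assume "x < N * N ^ n"
      then have "x div N < N ^ n" by (simp add: less_mult_imp_div_less mult.commute)
      then have "g (x div N) < N ^ n"
        using g(1) by (auto simp: bij_betw_def)
      then have "G x div N < N ^ n" by (simp add: G_div)
      then show "G x < N * N ^ n"
        using assms(1) by (simp add: div_less_iff_less_mult mult.commute)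
    qed
    then show ?thesis
      using inj endo_inj_surj[of "{..<N ^ Suc n}" G] by (simp add: bij_betw_def)
  qed
  ultimately show ?case using block by blast
qed

text \<open>Conjugation by the shift \<open>v - 1\<close>: the distance sees only equalities of
  block indices, which \<open>block_transitive\<close> preserves.\<close>

lemma vertex_transitive:
  assumes "N \<ge> 1" "u \<in> vertices N n" "w \<in> vertices N n"
  shows "\<exists>g. bij_betw g (vertices N n) (vertices N n) \<and> g u = w \<and>
    (\<forall>x y. hdist N (g x) (g y) = hdist N x y)"
proof -
  have "u - 1 < N ^ n" "w - 1 < N ^ n"
    using assms by (auto simp: vertices_def)
  then obtain g where g: "bij_betw g {..<N ^ n} {..<N ^ n}" "g (u - 1) = w - 1"
      "\<And>x y k. g x div N ^ k = g y div N ^ k \<longleftrightarrow> x div N ^ k = y div N ^ k"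
    using block_transitive[OF assms(1)] by blast
  have V: "vertices N n = Suc ` {..<N ^ n}"
    by (simp add: vertices_def image_Suc_lessThan)
  have "bij_betw (\<lambda>v. v - 1) (vertices N n) {..<N ^ n}"
    unfolding V by (auto simp: bij_betw_def inj_on_def image_image)
  moreover have "bij_betw Suc {..<N ^ n} (vertices N n)"
    unfolding V by (simp add: bij_betw_def)
  ultimately have "bij_betw (Suc \<circ> g \<circ> (\<lambda>v. v - 1)) (vertices N n) (vertices N n)"
    using g(1) by (metis bij_betw_trans)
  moreover have "(Suc \<circ> g \<circ> (\<lambda>v. v - 1)) u = w"
    using g(2) assms(3) by (simp add: vertices_def)
  moreover have "hdist N ((Suc \<circ> g \<circ> (\<lambda>v. v - 1)) x) ((Suc \<circ> g \<circ> (\<lambda>v. v - 1)) y) = hdist N x y" for x y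
    using g(3) by (simp add: hdist_def)
  ultimately show ?thesis by blast
qed

section \<open>Range and shells of the hierarchical distance\<close>

lemma hdist_commute: "hdist N v w = hdist N w v"
  by (simp add: hdist_def eq_commute)

lemma hdist_range:
  assumes "v \<in> vertices N n" "w \<in> vertices N n" "v \<noteq> w"
  shows "hdist N v w \<in> {1..n}"
proof -
  have less: "v - 1 < N ^ n" "w - 1 < N ^ n" using assms by (auto simp: vertices_def)
  then have "hdist N v w \<le> n"
    unfolding hdist_def by (intro Least_le) simp
  moreover have "(v - 1) div N ^ hdist N v w = (w - 1) div N ^ hdist N v w"
    unfolding hdist_def by (rule LeastI[of _ n]) (use less in simp)
  then have "hdist N v w \<noteq> 0"
    using assms by (auto simp: vertices_def intro: ccontr)
  ultimately show ?thesis by simp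
qed

text \<open>Summation by shells around vertex 1: in shifted coordinates the shell at distance
  \<open>Suc n\<close> is \<open>{N ^ n..<N ^ Suc n}\<close>, with
  \<open>(1 - 1 / N) * N ^ Suc n\<close> elements. Hence the sum in the field condition is the total
  coupling of one vertex.\<close>

lemma sum_hdist_first_vertex:
  assumes "N \<ge> 2"
  shows "(\<Sum>x\<in>{1..<N ^ n}. J (hdist N 1 (Suc x)))
    = (1 - 1 / real N) * (\<Sum>i=1..n. J i * real N ^ i)"
proof (induction n)
  case (Suc n)
  have "hdist N 1 (Suc x) = Suc n" if "x \<in> {N ^ n..<N ^ Suc n}" for x
    unfolding hdist_def
  proof (rule Least_equality)
    show "(1 - 1) div N ^ Suc n = (Suc x - 1) div N ^ Suc n"
      using that by simp
    show "Suc n \<le> k" if k: "(1 - 1) div N ^ k = (Suc x - 1) div N ^ k" for k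
    proof -
      have "x < N ^ k"
        using k assms by (simp add: div_eq_0_iff eq_commute[of 0])
      then have "N ^ n < N ^ k"
        using \<open>x \<in> {N ^ n..<N ^ Suc n}\<close> by simp
      then show ?thesis using assms by (simp add: power_strict_increasing_iff Suc_le_eq)
    qed
  qed
  then have "(\<Sum>x\<in>{N ^ n..<N ^ Suc n}. J (hdist N 1 (Suc x))) = real (N ^ Suc n - N ^ n) * J (Suc n)"
    by simp
  moreover have "real (N ^ Suc n - N ^ n) = (1 - 1 / real N) * real N ^ Suc n"
    using assms by (simp add: of_nat_diff field_simps)
  moreover have "(\<Sum>x\<in>{1..<N ^ Suc n}. J (hdist N 1 (Suc x)))
      = (\<Sum>x\<in>{1..<N ^ n}. J (hdist N 1 (Suc x))) + (\<Sum>x\<in>{N ^ n..<N ^ Suc n}. J (hdist N 1 (Suc x)))"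
    using assms by (intro sum.atLeastLessThan_concat[symmetric]) auto
  ultimately show ?case
    using Suc by (simp add: algebra_simps)
qed simp

section \<open>The Hamiltonian\<close>

text \<open>Vanishing on the diagonal lets pair sums run over a full Cartesian product, which suits
  reindexing and pointwise comparison.\<close>

definition coupling :: "nat \<Rightarrow> (nat \<Rightarrow> real) \<Rightarrow> nat \<Rightarrow> nat \<Rightarrow> real" where
  "coupling N J v w = (if v = w then 0 else J (hdist N v w))"

lemma Ham_eq_coupling:
  "Ham N n J h \<sigma> = - (1/4) * (\<Sum>(v, w)\<in>vertices N n \<times> vertices N n.
      coupling N J v w * (spin \<sigma> v * spin \<sigma> w)) - (h/2) * (\<Sum>v\<in>vertices N n. spin \<sigma> v)"
proof -
  have fin: "finite (vertices N n)" by (simp add: vertices_def)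
  have "(\<Sum>w\<in>vertices N n - {v}. J (hdist N v w) * spin \<sigma> v * spin \<sigma> w)
      = (\<Sum>w\<in>vertices N n. coupling N J v w * (spin \<sigma> v * spin \<sigma> w))" for v
    by (rule sum.mono_neutral_cong_left) (auto simp: fin coupling_def)
  then show ?thesis by (simp add: Ham_def sum.cartesian_product)
qed

lemma Ham_image:
  assumes g: "bij_betw g (vertices N n) (vertices N n)"
    and iso: "\<And>x y. hdist N (g x) (g y) = hdist N x y" and A: "A \<subseteq> vertices N n"
  shows "Ham N n J h (g ` A) = Ham N n J h A"
proof -
  let ?V = "vertices N n"
  have inj: "inj_on g ?V" using g by (simp add: bij_betw_def)
  have spin: "spin (g ` A) (g v) = spin A v" if "v \<in> ?V" for v
    using that inj A by (simp add: spin_def inj_on_image_mem_iff)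
  have coup: "coupling N J (g v) (g w) = coupling N J v w" if "v \<in> ?V" "w \<in> ?V" for v w
    using that inj iso by (auto simp: coupling_def inj_on_def)
  have "bij_betw (map_prod g g) (?V \<times> ?V) (?V \<times> ?V)"
    using g by (simp add: bij_betw_map_prod)
  then have "(\<Sum>(v, w)\<in>?V \<times> ?V. coupling N J v w * (spin (g ` A) v * spin (g ` A) w))
      = (\<Sum>p\<in>?V \<times> ?V. case map_prod g g p of (v, w) \<Rightarrow>
      coupling N J v w * (spin (g ` A) v * spin (g ` A) w))"
    by (rule sum.reindex_bij_betw[symmetric])
  also have "(\<Sum>p\<in>?V \<times> ?V. case map_prod g g p of (v, w) \<Rightarrow>
      coupling N J v w * (spin (g ` A) v * spin (g ` A) w))
    = (\<Sum>(v, w)\<in>?V \<times> ?V. coupling N J v w * (spin A v * spin A w))"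
    by (rule sum.cong) (auto simp: spin coup)
  finally have pairs: "(\<Sum>(v, w)\<in>?V \<times> ?V. coupling N J v w * (spin (g ` A) v * spin (g ` A) w))
    = (\<Sum>(v, w)\<in>?V \<times> ?V. coupling N J v w * (spin A v * spin A w))" .
  have "(\<Sum>v\<in>?V. spin (g ` A) v) = (\<Sum>v\<in>?V. spin (g ` A) (g v))"
    using g by (rule sum.reindex_bij_betw[symmetric])
  also have "\<dots> = (\<Sum>v\<in>?V. spin A v)"
    by (rule sum.cong) (auto simp: spin)
  finally show ?thesis by (simp add: Ham_eq_coupling pairs)
qed

lemma Ham_singleton:
  assumes "u \<in> vertices N n"
  shows "Ham N n J h {u} = Ham N n J h {} + (\<Sum>w\<in>vertices N n. coupling N J u w) - h"
proof -
  let ?V = "vertices N n" and ?K = "coupling N J"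
  have fin: "finite ?V" by (simp add: vertices_def)
  have sym: "?K v u = ?K u v" for v by (simp add: coupling_def hdist_commute)
  have "(\<Sum>v\<in>?V. \<Sum>w\<in>?V. if v = u then ?K u w else 0) = (\<Sum>w\<in>?V. ?K u w)"
    by (subst sum.swap) (simp add: fin assms)
  moreover have "(\<Sum>v\<in>?V. \<Sum>w\<in>?V. if w = u then ?K v u else 0) = (\<Sum>w\<in>?V. ?K u w)"
    by (simp add: fin assms sym)
  \<comment> \<open>Raising \<open>u\<close> reverses the sign of the ordered pairs with exactly one
    entry \<open>u\<close>. The two corrections overlap only in \<open>(u, u)\<close>, where the
    coupling is zero; the prefactor \<open>1/4\<close> later cancels the resulting factor 4.\<close>
  moreover have "(\<Sum>(v, w)\<in>?V \<times> ?V. ?K v w * (spin {u} v * spin {u} w))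
      = (\<Sum>v\<in>?V. \<Sum>w\<in>?V. ?K v w - 2 * (if v = u then ?K u w else 0) - 2 * (if w = u then ?K v u else 0))"
    unfolding sum.cartesian_product[symmetric]
    by (intro sum.cong refl) (auto simp: spin_def coupling_def)
  ultimately have "(\<Sum>(v, w)\<in>?V \<times> ?V. ?K v w * (spin {u} v * spin {u} w))
      = (\<Sum>v\<in>?V. \<Sum>w\<in>?V. ?K v w) - 4 * (\<Sum>w\<in>?V. ?K u w)"
    by (simp only: sum_subtractf sum_distrib_left[symmetric])
  then have pairs: "(\<Sum>(v, w)\<in>?V \<times> ?V. ?K v w * (spin {u} v * spin {u} w))
      = (\<Sum>(v, w)\<in>?V \<times> ?V. ?K v w) - 4 * (\<Sum>w\<in>?V. ?K u w)"
    by (simp add: sum.cartesian_product)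
  have "(\<Sum>v\<in>?V. spin {u} v) = (\<Sum>v\<in>?V. - 1 + (if v = u then 2 else 0))"
    by (rule sum.cong) (auto simp: spin_def)
  then have "(\<Sum>v\<in>?V. spin {u} v) = (\<Sum>v\<in>?V. - 1) + 2"
    using fin assms by (simp only: sum.distrib sum.delta) simp
  then have field: "(h/2) * (\<Sum>v\<in>?V. spin {u} v) = (h/2) * (\<Sum>v\<in>?V. - 1) + h"
    by (metis distrib_left field_sum_of_halves mult_2_right)
  have "(\<Sum>(v, w)\<in>?V \<times> ?V. ?K v w * (spin {} v * spin {} w)) = (\<Sum>(v, w)\<in>?V \<times> ?V. ?K v w)"
    "(\<Sum>v\<in>?V. spin {} v) = (\<Sum>v\<in>?V. - 1)"
    by (simp_all add: spin_def)
  then show ?thesis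
    unfolding Ham_eq_coupling pairs field by (simp add: field_simps)
qed

section \<open>Submodularity, symmetry and ground state of the ferromagnetic energy\<close>

locale hierarchical_ising =
  fixes N n :: nat and J :: "nat \<Rightarrow> real" and h :: real
  assumes N: "N \<ge> 2" and h_pos: "h > 0" and J_pos: "\<And>i. i \<in> {1..n} \<Longrightarrow> J i > 0"
begin

abbreviation V where "V \<equiv> vertices N n"
abbreviation H where "H \<equiv> Ham N n J h"

lemma coupling_nonneg: "\<lbrakk>v \<in> V; w \<in> V\<rbrakk> \<Longrightarrow> coupling N J v w \<ge> 0"
  using J_pos[of "hdist N v w"] hdist_range[of v N n w] by (simp add: coupling_def less_imp_le)

text \<open>The field term is modular, and pair terms compare pointwise with nonnegative weights.
  Strictness comes from \<open>a \<in> A - B\<close> and \<open>b \<in> B - A\<close>: their spins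
  agree in the union and in the intersection but disagree in \<open>A\<close> and in
  \<open>B\<close>.\<close>

lemma Ham_strictly_submodular: "strictly_submodular V H"
proof
  show fin: "finite V" by (simp add: vertices_def)
  fix A B assume AB: "A \<subseteq> V" "B \<subseteq> V" "\<not> A \<subseteq> B" "\<not> B \<subseteq> A"
  obtain a b where ab: "a \<in> A" "a \<notin> B" "b \<in> B" "b \<notin> A" using AB by blast
  define P where "P \<sigma> = (\<Sum>(v, w)\<in>V \<times> V. coupling N J v w * (spin \<sigma> v * spin \<sigma> w))" for \<sigma>
  have "P A + P B < P (A \<union> B) + P (A \<inter> B)"
    unfolding P_def sum.distrib[symmetric]
  proof (rule sum_strict_mono_ex1)
    show "finite (V \<times> V)" using fin by simp
    have "coupling N J v w * (spin A v * spin A w) + coupling N J v w * (spin B v * spin B w)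
       \<le> coupling N J v w * (spin (A \<union> B) v * spin (A \<union> B) w)
          + coupling N J v w * (spin (A \<inter> B) v * spin (A \<inter> B) w)" if "v \<in> V" "w \<in> V" for v w
      using coupling_nonneg[OF that] unfolding distrib_left[symmetric]
      by (intro mult_left_mono) (auto simp: spin_def)
    then show "\<forall>x\<in>V \<times> V. (case x of (v, w) \<Rightarrow> coupling N J v w * (spin A v * spin A w))
        + (case x of (v, w) \<Rightarrow> coupling N J v w * (spin B v * spin B w))
      \<le> (case x of (v, w) \<Rightarrow> coupling N J v w * (spin (A \<union> B) v * spin (A \<union> B) w))
        + (case x of (v, w) \<Rightarrow> coupling N J v w * (spin (A \<inter> B) v * spin (A \<inter> B) w))"
      by auto
    have "coupling N J a b > 0"
      using J_pos hdist_range[of a N n b] ab AB by (auto simp: coupling_def)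
    then show "\<exists>x\<in>V \<times> V. (case x of (v, w) \<Rightarrow> coupling N J v w * (spin A v * spin A w))
        + (case x of (v, w) \<Rightarrow> coupling N J v w * (spin B v * spin B w))
      < (case x of (v, w) \<Rightarrow> coupling N J v w * (spin (A \<union> B) v * spin (A \<union> B) w))
        + (case x of (v, w) \<Rightarrow> coupling N J v w * (spin (A \<inter> B) v * spin (A \<inter> B) w))"
      using ab AB by (intro bexI[of _ "(a, b)"]) (auto simp: spin_def)
  qed
  moreover have "(\<Sum>v\<in>V. spin (A \<union> B) v) + (\<Sum>v\<in>V. spin (A \<inter> B) v)
      = (\<Sum>v\<in>V. spin A v) + (\<Sum>v\<in>V. spin B v)"
    unfolding sum.distrib[symmetric] by (rule sum.cong) (auto simp: spin_def)
  then have "(h/2) * (\<Sum>v\<in>V. spin (A \<union> B) v) + (h/2) * (\<Sum>v\<in>V. spin (A \<inter> B) v)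
      = (h/2) * (\<Sum>v\<in>V. spin A v) + (h/2) * (\<Sum>v\<in>V. spin B v)"
    by (metis distrib_left)
  ultimately show "H (A \<union> B) + H (A \<inter> B) < H A + H B"
    unfolding Ham_eq_coupling P_def[symmetric] by simp
qed

sublocale strictly_submodular V H
  by (rule Ham_strictly_submodular)

lemma Ham_transitive:
  assumes "u \<in> V" "w \<in> V"
  shows "\<exists>g. bij_betw g V V \<and> g u = w \<and> (\<forall>A\<subseteq>V. H (g ` A) = H A)"
proof -
  obtain g where "bij_betw g V V" "g u = w" "\<forall>x y. hdist N (g x) (g y) = hdist N x y"
    using vertex_transitive[OF _ assms] N by auto
  then show ?thesis using Ham_image[of g N n] by blast
qed

lemma Ham_full_le: "H V \<le> H \<sigma>"
proof -
  have "(\<Sum>(v, w)\<in>V \<times> V. coupling N J v w * (spin \<sigma> v * spin \<sigma> w))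
      \<le> (\<Sum>(v, w)\<in>V \<times> V. coupling N J v w * (spin V v * spin V w))"
  proof (rule sum_mono, clarify)
    fix v w assume vw: "v \<in> V" "w \<in> V"
    show "coupling N J v w * (spin \<sigma> v * spin \<sigma> w) \<le> coupling N J v w * (spin V v * spin V w)"
      using vw by (intro mult_left_mono coupling_nonneg) (auto simp: spin_def)
  qed
  moreover have "(\<Sum>v\<in>V. spin \<sigma> v) \<le> (\<Sum>v\<in>V. spin V v)"
    by (rule sum_mono) (simp add: spin_def)
  then have "(h/2) * (\<Sum>v\<in>V. spin \<sigma> v) \<le> (h/2) * (\<Sum>v\<in>V. spin V v)"
    using h_pos by (intro mult_left_mono) auto
  ultimately show ?thesis
    unfolding Ham_eq_coupling by simp
qed

text \<open>The two constant configurations have equal interaction energy, so the positive field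
  decides.\<close>

lemma Ham_full_less_empty: "H V < H {}"
proof -
  have "(\<Sum>(v, w)\<in>V \<times> V. coupling N J v w * (spin V v * spin V w))
      = (\<Sum>(v, w)\<in>V \<times> V. coupling N J v w * (spin {} v * spin {} w))"
    by (rule sum.cong) (auto simp: spin_def)
  moreover have "(\<Sum>v\<in>V. spin V v) = real (card V)" "(\<Sum>v\<in>V. spin {} v) = - real (card V)"
    by (simp_all add: spin_def)
  moreover have "card V > 0" using N by (simp add: vertices_def)
  ultimately show ?thesis
    using h_pos by (simp add: Ham_eq_coupling)
qed

end

section \<open>Metastability\<close>

locale metastable_hierarchical_ising = hierarchical_ising +
  assumes field_bound: "(1 - 1 / real N) * (\<Sum>i=1..n. J i * real N ^ i) > h"
begin

text \<open>At vertex 1 this is the field condition, by \<open>Ham_singleton\<close> and the shell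
  sum; an automorphism carries it to every vertex.\<close>

lemma Ham_empty_less_singleton:
  assumes "v \<in> V"
  shows "H {} < H {v}"
proof -
  have one: "1 \<in> V" using N by (simp add: vertices_def)
  obtain g where g: "g v = 1" "\<forall>A\<subseteq>V. H (g ` A) = H A"
    using Ham_transitive[OF assms one] by blast
  have "H {1} = H {v}" using g assms by (metis image_empty image_insert empty_subsetI insert_subset)
  moreover have "(\<Sum>w\<in>V. coupling N J 1 w) = (\<Sum>x\<in>{1..<N ^ n}. J (hdist N 1 (Suc x)))"
  proof -
    have "V = insert 1 (Suc ` {1..<N ^ n})"
      using one by (auto simp: vertices_def image_Suc_atLeastLessThan)
    then have "(\<Sum>w\<in>V. coupling N J 1 w) = (\<Sum>w\<in>Suc ` {1..<N ^ n}. coupling N J 1 w)"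
      by (simp add: coupling_def)
    also have "\<dots> = (\<Sum>x\<in>{1..<N ^ n}. J (hdist N 1 (Suc x)))"
      by (subst sum.reindex) (auto simp: coupling_def)
    finally show ?thesis .
  qed
  ultimately show ?thesis
    using Ham_singleton[OF one] sum_hdist_first_vertex[OF N] field_bound by simp
qed

text \<open>The first step away from the empty configuration reaches a singleton. The strict
  inequality supplies \<open>f {} < c\<close> for \<open>union_height\<close>.\<close>

lemma empty_path_height:
  assumes "is_path N n p {} \<eta>" "\<eta> \<noteq> {}"
  shows "H {} < Max (H ` set p)"
proof -
  have p: "p \<noteq> []" "p ! 0 = {}" "last p = \<eta>"
    using assms by (auto simp: is_path_def hd_conv_nth)
  then have "length p > 1"
    using assms(2) by (cases p) (auto split: if_splits)
  then have "neighbours N n (p ! 0) (p ! 1)" "p ! 1 \<in> set p"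
    using assms(1) by (auto simp: is_path_def)
  then obtain v where "v \<in> V" "{v} \<in> set p"
    using p(2) by (auto simp: neighbours_def)
  then have "H {} < H {v}" "H {v} \<le> Max (H ` set p)"
    using Ham_empty_less_singleton by auto
  then show ?thesis by simp
qed

lemma grows_from_path:
  assumes "is_path N n p {} \<eta>"
  shows "\<exists>A. grows (Max (H ` set p)) A \<and> H A \<le> H \<eta>"
proof -
  have p: "p \<noteq> []" "p ! 0 = {}" "p ! (length p - 1) = \<eta>"
      "\<And>i. Suc i < length p \<Longrightarrow> neighbours N n (p ! i) (p ! Suc i)"
    using assms by (auto simp: is_path_def hd_conv_nth last_conv_nth)
  have "\<exists>A. grows (Max (H ` set p)) A \<and> H A \<le> H (p ! (length p - 1))"
  proof (rule path_dominated_by_grows)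
    show "p ! 0 = {}" by (rule p)
    show "H (p ! i) \<le> Max (H ` set p)" if "i \<le> length p - 1" for i
    proof -
      have "i < length p" using that p(1) by (cases p) auto
      then show ?thesis by simp
    qed
    show "\<exists>v\<in>V. p ! Suc i = insert v (p ! i) \<or> p ! Suc i = p ! i - {v}" if "i < length p - 1" for i
    proof -
      have "neighbours N n (p ! i) (p ! Suc i)"
        using that by (intro p(4)) linarith
      then obtain v where "v \<in> V" "p ! Suc i = p ! i \<union> {v} - (p ! i \<inter> {v})"
        unfolding neighbours_def by blast
      moreover have "p ! i \<union> {v} - (p ! i \<inter> {v}) = (if v \<in> p ! i then p ! i - {v} else insert v (p ! i))"
        by auto
      ultimately show ?thesis by (intro bexI[of _ v]) auto
    qed
  qed
  then show ?thesis using p(3) by simp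
qed

lemma stab_level_less_empty:
  assumes \<sigma>: "\<sigma> \<subseteq> V" "\<sigma> \<noteq> {}" "\<sigma> \<noteq> V"
  shows "stab_level N n J h \<sigma> < stab_level N n J h {}"
proof -
  obtain p \<eta> where p: "is_path N n p {} \<eta>" "H \<eta> < H {}"
      and max: "Max (H ` set p) = H {} + stab_level N n J h {}"
    using stab_level_empty_attained[of V N n J h] Ham_full_less_empty by (auto simp: configs_def)
  \<comment> \<open>By \<open>max\<close>, \<open>c - H {}\<close> is the stability level of the
    empty configuration, the barrier to be undercut.\<close>
  define c where "c = Max (H ` set p)"
  have c: "H {} < c"
    using empty_path_height[OF p(1)] p(2) unfolding c_def by auto
  obtain A0 where A0: "grows c A0" "H A0 < H {}"
    using grows_from_path[OF p(1)] p(2) unfolding c_def by force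
  obtain A u where A: "grows c A" "u \<in> V" "u \<notin> A" "\<not> \<sigma> \<subseteq> A" "\<not> insert u A \<subseteq> \<sigma>"
      "\<And>B. B \<subseteq> A \<Longrightarrow> H {} \<le> H B" "\<And>B. B \<subset> insert u A \<Longrightarrow> H (insert u A) < H B"
    using critical_droplet[OF A0 Ham_transitive \<sigma>] by blast
  \<comment> \<open>The chain is replayed on \<sigma> up to \<open>A\<close>: its stages do not
    contain \<sigma>, and their intersections with \<sigma> are subsets of \<open>A\<close>, of
    energy at least \<open>H {}\<close>.\<close>
  have path: "\<exists>q. is_path N n q \<sigma> (\<sigma> \<union> C) \<and> (\<forall>\<xi>\<in>set q. H \<xi> < H \<sigma> + (c - H {}))"
    if "grows c C" "C \<subseteq> A" for C
    using that
  proof (induction rule: grows.induct)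
    case empty
    have "is_path N n [\<sigma>] \<sigma> \<sigma>"
      using \<sigma>(1) by (intro is_path_refl) (simp add: configs_def)
    then show ?case using c by (intro exI[of _ "[\<sigma>]"]) simp
  next
    case (insert C v)
    then obtain q where q: "is_path N n q \<sigma> (\<sigma> \<union> C)" "\<forall>\<xi>\<in>set q. H \<xi> < H \<sigma> + (c - H {})"
      by auto
    have "insert v C \<inter> \<sigma> \<subseteq> A" using insert.prems by blast
    then have "H (\<sigma> \<union> insert v C) < H \<sigma> + (c - H {})"
      using insert.prems insert.hyps A(4) grows_subset[OF insert.hyps(1)] \<sigma>(1) c A(6)
      by (intro union_height) auto
    moreover obtain q' where "is_path N n q' \<sigma> (\<sigma> \<union> insert v C)"
        "set q' \<subseteq> insert (\<sigma> \<union> insert v C) (set q)"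
      using is_path_insert[OF q(1) insert.hyps(2)] by auto
    ultimately show ?case
      using q(2) by (intro exI[of _ q']) auto
  qed
  obtain q where q: "is_path N n q \<sigma> (\<sigma> \<union> A)" "\<forall>\<xi>\<in>set q. H \<xi> < H \<sigma> + (c - H {})"
    using path[OF A(1)] by blast
  have AV: "insert u A \<subseteq> V" using A(2) grows_subset[OF A(1)] by simp
  \<comment> \<open>The intersection is a proper subset because \<sigma> does not contain the
    droplet; submodularity then turns this into a strict energy gain over \<sigma>.\<close>
  have "H (insert u A) < H (\<sigma> \<inter> insert u A)"
    using A(5) by (intro A(7)) blast
  then have lower: "H (insert u (\<sigma> \<union> A)) < H \<sigma>"
    using submodular[OF \<sigma>(1) AV] by simp
  obtain q' where q': "is_path N n q' \<sigma> (insert u (\<sigma> \<union> A))"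
      "set q' \<subseteq> insert (insert u (\<sigma> \<union> A)) (set q)"
    using is_path_insert[OF q(1) A(2)] by blast
  have "stab_level N n J h \<sigma> < c - H {}"
  proof (rule stab_level_less[OF q'(1) lower])
    \<comment> \<open>The only configuration added by the last step is the end, which already lies
      below \<open>H \<sigma>\<close>.\<close>
    show "H \<xi> < H \<sigma> + (c - H {})" if "\<xi> \<in> set q'" for \<xi>
      using that q'(2) q(2) lower c by fastforce
  qed
  then show ?thesis using max by (simp add: c_def)
qed

lemma Omega_meta_eq: "Omega_meta N n J h = {{}}"
proof -
  let ?S = "configs N n - Omega_stab N n J h" and ?l = "stab_level N n J h"
  have V: "V \<in> Omega_stab N n J h"
    using Ham_full_le by (simp add: Omega_stab_def configs_def)
  have empty: "{} \<in> ?S"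
    using Ham_full_less_empty by (force simp: Omega_stab_def configs_def)
  \<comment> \<open>Stability of \<open>V\<close> excludes it from \<open>?S\<close>, so every
    nonempty member meets the hypotheses of the comparison.\<close>
  have less: "?l \<sigma> < ?l {}" if "\<sigma> \<in> ?S" "\<sigma> \<noteq> {}" for \<sigma>
    using that V by (intro stab_level_less_empty) (auto simp: configs_def)
  have "Max (?l ` ?S) = ?l {}"
  proof (rule Max_eqI)
    show "finite (?l ` ?S)" using finite_configs by simp
    show "?l {} \<in> ?l ` ?S" using empty by blast
    show "y \<le> ?l {}" if "y \<in> ?l ` ?S" for y
      using that less by (force intro: less_imp_le)
  qed
  then show ?thesis
    using empty less unfolding Omega_meta_def by force
qed

end

theorem theorem1p8:
  fixes N n :: nat and J :: "nat \<Rightarrow> real" and h :: real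
  assumes "N \<ge> 2" and "n \<ge> 1" and "h > 0"
    and "\<forall>i\<in>{1..n}. J i > 0"
    and "(\<forall>i j. 1 \<le> i \<and> i \<le> j \<and> j \<le> n \<longrightarrow> J j \<le> J i) \<or>
         (\<forall>i j. 1 \<le> i \<and> i \<le> j \<and> j \<le> n \<longrightarrow> J i \<le> J j)"
    and "(1 - 1 / real N) * (\<Sum>i=1..n. J i * real N ^ i) > h"
  shows "Omega_meta N n J h = {{}}"
proof -
  interpret metastable_hierarchical_ising N n J h
    using assms(1,3,4,6) by unfold_locales blast+
  show ?thesis by (rule Omega_meta_eq)
qed

end
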